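(* Consider the completely positive program $$v_p:=\min\{\operatorname{tr}(CX):\ \operatorname{tr}(A_iX)=b_i,\ i=1,\dots,m,\ X\in\mathcal{CP}^n\}\qquad(\mathrm{P})$$ with $C,A_1,\dots,A_m\in\mathcal S^n$ and $b\in\mathbb R^m$, satisfying the standing assumptions A1, A2, A3 given in the context. Assume that $(\mathrm P)$ is strictly feasible. Let $\{(G^k,U^k)\}$ be a positively enlarging sequence such that $$\lim_{k\to\infty}\ \max_{x\in\Delta^n}\ \min_{y\in \operatorname{seg}(G^k,U^k)}\|x-y\|=0 .$$ For each $k$ consider the problem $$v_p(G^k,U^k):=\min\{\operatorname{tr}(CX):\ \operatorname{tr}(A_iX)=b_i,\ i=1,\dots,m,\ X\in \mathrm{SDD}^{G^k}_+(U^k)\}.\qquad(\mathrm{P}_k)$$ Then: (i) $v_p(G^k,U^k)$ is finite for all sufficiently large $k$ and $\lim_{k\to\infty}v_p(G^k,U^k)=v_p$. (ii) The solution set of $(\mathrm P_k)$ is nonempty and uniformly bounded for all sufficiently large $k$. (iii) Let $X^k$ be a solution of $(\mathrm P_k)$ whenever the solution set is nonempty. Then any accumulation point of $\{X^k\}$ is a solution of $(\mathrm P)$.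
   Context: $\mathcal S^n$ is the space of real symmetric $n\times n$ matrices, $\mathcal S^n_+$ the cone of positive semidefinite ones, $\mathcal N^n$ the cone of entrywise nonnegative ones. $\mathcal{CP}^n=\{X\in\mathcal S^n:\exists B\ge 0 \text{ (entrywise)},\ X=B^TB\}$ is the cone of completely positive matrices ($B$ may have any number of rows). $\mathcal{COP}^n=\{X\in\mathcal S^n: v^TXv\ge 0\ \forall v\ge 0\}$ is the cone of copositive matrices. $\Delta^n=\{x\in\mathbb R^n_+:\sum_i x_i=1\}$. Standing assumptions on $(\mathrm P)$. A1: $(\mathrm P)$ is feasible. A2: the map $\mathcal S^n\to\mathbb R^m$, $X\mapsto(\operatorname{tr}(A_1X),\dots,\operatorname{tr}(A_mX))$, is surjective. A3: there is $\bar y\in\mathbb R^m$ with $C-\sum_{i=1}^m\bar y_iA_i\in\operatorname{int}\mathcal{COP}^n$. "$(\mathrm P)$ is strictly feasible" means that there is $X\in\operatorname{int}\mathcal{CP}^n$ with $\operatorname{tr}(A_iX)=b_i$ for all $i$. The optimal value of an infeasible minimization problem is $+\infty$. For $1\le i<j\le t$, $\iota_{ij}:\mathcal S^2\to\mathcal S^t$ sends $S$ to the matrix whose principal submatrix on rows and columns $i,j$ (in this order) is $S$ and whose other entries are $0$. For a (simple, undirected) graph $G$ with vertex set $\{1,\dots,t\}$ and edge set $\mathcal E$, $\mathrm{SDD}^G=\sum_{\{i,j\}\in\mathcal E}\iota_{ij}(\mathcal S^2_+)\subseteq\mathcal S^t$ (equal to $\{0\}$ if $\mathcal E=\emptyset$)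 and $\mathrm{SDD}^G_+=\mathrm{SDD}^G\cap\mathcal N^t$. For $U\in\mathbb R^{t\times n}_+$ whose rows $u_1,\dots,u_t$ each have sum one, $\mathrm{SDD}^G_+(U)=\{U^TYU: Y\in\mathrm{SDD}^G_+\}\subseteq\mathcal S^n$ and $\operatorname{seg}(G,U)=\bigcup_{\{i,j\}\in\mathcal E}[u_i,u_j]\subseteq\Delta^n$, where $[u,v]=\{su+(1-s)v:s\in[0,1]\}$. A sequence $\{(G^k,U^k)\}$, where $G^k$ is a graph on $t_k$ vertices and $U^k\in\mathbb R^{t_k\times n}$, is called a positively enlarging sequence if for every $k$: $\operatorname{seg}(G^k,U^k)\subseteq\operatorname{seg}(G^{k+1},U^{k+1})$; $U^k$ is entrywise nonnegative with at least $n$ rows; each row of $U^k$ sums to one; and each node of $G^k$ is covered by at least one edge. *)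

theory Defs
  imports "HOL-Analysis.Analysis"
begin

definition sym_mats :: "(real^'n^'n) set" where
  "sym_mats = {X. transpose X = X}"

definition psd_mats :: "(real^'n^'n) set" where
  "psd_mats = {X \<in> sym_mats. \<forall>v. 0 \<le> v \<bullet> (X *v v)}"

text \<open>The matrix B has r rows, r arbitrary; its p-th row is the vector \<open>B p\<close>, and the
  right-hand side is the entrywise form of the product of the transpose of B with B.\<close>

definition cp_mats :: "(real^'n^'n) set" where
  "cp_mats = {X \<in> sym_mats. \<exists>r (B :: nat \<Rightarrow> real^'n).
     (\<forall>p<r. \<forall>a. 0 \<le> B p $ a) \<and> X = (\<chi> a b. \<Sum>p<r. B p $ a * B p $ b)}"

definition cop_mats :: "(real^'n^'n) set" where
  "cop_mats = {X \<in> sym_mats. \<forall>v. (\<forall>a. 0 \<le> v $ a) \<longrightarrow> 0 \<le> v \<bullet> (X *v v)}"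

text \<open>The interior is taken in the space of symmetric matrices: in the space of all square
  matrices both cones have empty interior as soon as the order is at least two.\<close>

definition sym_interior :: "(real^'n^'n) set \<Rightarrow> (real^'n^'n) set" where
  "sym_interior K = (top_of_set sym_mats) interior_of K"

definition std_simplex :: "(real^'n) set" where
  "std_simplex = {x. (\<forall>a. 0 \<le> x $ a) \<and> (\<Sum>a\<in>UNIV. x $ a) = 1}"


text \<open>The number of vertices of a graph varies within one statement, so the corresponding
  matrices cannot be indexed by a type. Graphs have vertex set \<open>{1..t}\<close> and a set of
  two-element edges. A square matrix of order t is a function \<open>nat \<Rightarrow> nat \<Rightarrow> real\<close> read at
  indices in \<open>{1..t}\<close>, and a matrix with t rows and columns indexed by \<open>'n\<close> is given by its
  rows \<open>U i\<close>, \<open>i \<in> {1..t}\<close>.\<close>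

definition simple_graph :: "nat \<Rightarrow> nat set set \<Rightarrow> bool" where
  "simple_graph t E \<longleftrightarrow> (\<forall>e\<in>E. e \<subseteq> {1..t} \<and> card e = 2)"

definition iota :: "nat \<Rightarrow> nat \<Rightarrow> real^2^2 \<Rightarrow> nat \<Rightarrow> nat \<Rightarrow> real" where
  "iota i j S = (\<lambda>p q.
     if p = i \<and> q = i then S $ 1 $ 1
     else if p = i \<and> q = j then S $ 1 $ 2
     else if p = j \<and> q = i then S $ 2 $ 1
     else if p = j \<and> q = j then S $ 2 $ 2
     else 0)"

text \<open>The Minkowski sum over the edges, each edge \<open>{i, j}\<close> with \<open>i < j\<close> being represented by
  the pair \<open>(i, j)\<close>. On graphs in the above sense the edge set is finite, and all matrices
  obtained vanish outside \<open>{1..t} \<times> {1..t}\<close>.\<close>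

definition sdd :: "nat set set \<Rightarrow> (nat \<Rightarrow> nat \<Rightarrow> real) set" where
  "sdd E = {Y. \<exists>S :: nat \<Rightarrow> nat \<Rightarrow> real^2^2.
     (\<forall>i j. i < j \<and> {i, j} \<in> E \<longrightarrow> S i j \<in> psd_mats) \<and>
     Y = (\<lambda>p q. \<Sum>(i, j) \<in> {(i, j). i < j \<and> {i, j} \<in> E}. iota i j (S i j) p q)}"

definition sdd_nonneg :: "nat \<Rightarrow> nat set set \<Rightarrow> (nat \<Rightarrow> nat \<Rightarrow> real) set" where
  "sdd_nonneg t E = {Y \<in> sdd E. \<forall>p\<in>{1..t}. \<forall>q\<in>{1..t}. 0 \<le> Y p q}"

text \<open>The matrix in the definition is the product of the transpose of U, Y and U.\<close>

definition sdd_cone :: "nat \<Rightarrow> nat set set \<Rightarrow> (nat \<Rightarrow> real^'n) \<Rightarrow> (real^'n^'n) set" where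
  "sdd_cone t E U =
     (\<lambda>Y. \<chi> a b. \<Sum>p=1..t. \<Sum>q=1..t. U p $ a * Y p q * U q $ b) ` sdd_nonneg t E"

definition seg :: "nat set set \<Rightarrow> (nat \<Rightarrow> real^'n) \<Rightarrow> (real^'n) set" where
  "seg E U = \<Union>{closed_segment (U i) (U j) | i j. {i, j} \<in> E}"

definition positively_enlarging ::
  "(nat \<Rightarrow> nat) \<Rightarrow> (nat \<Rightarrow> nat set set) \<Rightarrow> (nat \<Rightarrow> nat \<Rightarrow> real^'n) \<Rightarrow> bool" where
  "positively_enlarging t E U \<longleftrightarrow> (\<forall>k.
     simple_graph (t k) (E k) \<and>
     seg (E k) (U k) \<subseteq> seg (E (Suc k)) (U (Suc k)) \<and>
     CARD('n) \<le> t k \<and>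
     (\<forall>i\<in>{1..t k}. \<forall>a. 0 \<le> U k i $ a) \<and>
     (\<forall>i\<in>{1..t k}. (\<Sum>a\<in>UNIV. U k i $ a) = 1) \<and>
     (\<forall>i\<in>{1..t k}. \<exists>e\<in>E k. i \<in> e))"


definition feasible ::
  "nat \<Rightarrow> (nat \<Rightarrow> real^'n^'n) \<Rightarrow> (nat \<Rightarrow> real) \<Rightarrow> (real^'n^'n) set \<Rightarrow> (real^'n^'n) set" where
  "feasible m A b K = {X \<in> K. \<forall>i\<in>{1..m}. trace (A i ** X) = b i}"

text \<open>The infimum is taken in the extended reals, so it is \<open>\<infinity>\<close> for an infeasible problem and
  \<open>-\<infinity>\<close> for an unbounded one.\<close>

definition opt_val :: "real^'n^'n \<Rightarrow> (real^'n^'n) set \<Rightarrow> ereal" where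
  "opt_val C F = (INF X\<in>F. ereal (trace (C ** X)))"

definition solutions :: "real^'n^'n \<Rightarrow> (real^'n^'n) set \<Rightarrow> (real^'n^'n) set" where
  "solutions C F = {X \<in> F. \<forall>Z\<in>F. trace (C ** X) \<le> trace (C ** Z)}"

end

theory Submission
  imports Defs
begin

text \<open>
  Both kinds of cones are generated by rank-one matrices \<open>x x\<^sup>T\<close>: the completely positive cone by
  the points \<open>x\<close> of the simplex (\<open>cp_mats_eq_hull\<close>), and the cone of a pair \<open>(G, U)\<close> by the points
  of \<open>seg G U\<close> (\<open>sdd_cone_eq_hull\<close>). The latter rests on the fact that a positive semidefinite
  2 by 2 matrix with nonnegative entries is a sum of matrices \<open>w w\<^sup>T\<close> with \<open>w \<ge> 0\<close>. As the
  generators have entrywise sum 1 and form a compact set, all these cones are closed.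

  Along a positively enlarging sequence the cones therefore increase, stay inside the completely
  positive cone, and have a dense union as soon as the segments become dense in the simplex. The
  union is convex, so it contains the relative interior of the completely positive cone
  (\<open>rel_interior_subset_dense_convex_subset\<close>); in particular a strictly feasible point is feasible
  for all later approximations.

  An interior point of the copositive cone pairs with completely positive matrices at least as a
  positive multiple of the norm (\<open>interior_copositive_coercive\<close>). The dual strict feasibility thus
  makes the sublevel sets of the objective bounded on the feasible set. Solutions exist by
  compactness, and those of the approximations lie in one sublevel set. The values
  converge because every feasible point is a limit of feasible points in the relative interior
  (\<open>minimal_values_converge\<close>), and an accumulation point of solutions is feasible by closedness
  and has the limit of the values as its value.
\<close>

section \<open>Rank-one matrices and trace functionals\<close>

definition rank_one :: "real^'n \<Rightarrow> real^'n^'n" where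
  "rank_one x = (\<chi> a b. x $ a * x $ b)"

lemma rank_one_scaleR: "rank_one (c *\<^sub>R x) = c\<^sup>2 *\<^sub>R rank_one x"
  by (simp add: rank_one_def vec_eq_iff power2_eq_square)

lemma continuous_rank_one: "continuous_on S rank_one"
  unfolding rank_one_def by (intro continuous_intros)

lemma trace_mult_eq: "trace (M ** X) = (\<Sum>a\<in>UNIV. \<Sum>b\<in>UNIV. M $ a $ b * X $ b $ a)"
  by (simp add: trace_def matrix_matrix_mult_def)

lemma linear_trace_right: "linear (\<lambda>X. trace ((M :: real^'n^'n) ** X))"
  by (rule linearI) (simp_all add: trace_mult_eq algebra_simps sum.distrib sum_distrib_left)

lemma linear_trace_left: "linear (\<lambda>M. trace (M ** (X :: real^'n^'n)))"
  by (rule linearI) (simp_all add: trace_mult_eq algebra_simps sum.distrib sum_distrib_left)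

lemma trace_rank_one: "trace (M ** rank_one x) = x \<bullet> (M *v x)"
  by (simp add: trace_mult_eq rank_one_def inner_vec_def matrix_vector_mult_def
      sum_distrib_left mult_ac)

lemma subspace_sym_mats: "subspace sym_mats"
  by (auto simp: subspace_def sym_mats_def transpose_def vec_eq_iff)

lemma rank_one_in_sym_mats: "rank_one x \<in> sym_mats"
  by (simp add: sym_mats_def transpose_def rank_one_def mult.commute)

lemma convex_cone_sum:
  assumes "convex_cone K" "\<And>i. i \<in> I \<Longrightarrow> f i \<in> K"
  shows "sum f I \<in> K"
  using assms(2)
  by (induction I rule: infinite_finite_induct)
    (auto intro: convex_cone_contains_0 convex_cone_add assms(1))

text \<open>Unless \<open>p\<close> and \<open>q\<close> vanish, the matrix is \<open>(p + q)\<^sup>2\<close> times the rank-one matrix of a point of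
  the segment.\<close>

lemma rank_one_nonneg_combination_mem:
  assumes K: "convex_cone K"
    and seg: "\<And>x. x \<in> closed_segment u v \<Longrightarrow> rank_one x \<in> K"
    and nonneg: "0 \<le> p" "0 \<le> q"
  shows "rank_one (p *\<^sub>R u + q *\<^sub>R v) \<in> K"
proof (cases "p + q = 0")
  case True
  then have "rank_one (p *\<^sub>R u + q *\<^sub>R v) = 0"
    using nonneg by (simp add: add_nonneg_eq_0_iff rank_one_def vec_eq_iff)
  then show ?thesis
    using convex_cone_contains_0 [OF K] by simp
next
  case False
  define x where "x = (1 - q / (p + q)) *\<^sub>R u + (q / (p + q)) *\<^sub>R v"
  have "x \<in> closed_segment u v"
    unfolding x_def closed_segment_def using False nonneg
    by (auto intro!: exI [of _ "q / (p + q)"] simp: divide_le_eq_1)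
  moreover have "p *\<^sub>R u + q *\<^sub>R v = (p + q) *\<^sub>R x"
  proof -
    have "p = (p + q) * (1 - q / (p + q))" "q = (p + q) * (q / (p + q))"
      using False by (simp_all add: right_diff_distrib)
    then show ?thesis
      unfolding x_def scaleR_right_distrib scaleR_scaleR by metis
  qed
  ultimately show ?thesis
    using seg convex_cone_scaleR [OF K] by (simp add: rank_one_scaleR)
qed

section \<open>The completely positive cone\<close>

lemma mem_cp_mats_iff:
  fixes X :: "real^'n^'n"
  shows "X \<in> cp_mats \<longleftrightarrow>
    (\<exists>(r::nat) B. (\<forall>p<r. \<forall>a. 0 \<le> B p $ a) \<and> X = (\<Sum>p<r. rank_one (B p)))"
proof -
  have "(\<chi> a b. \<Sum>p<r. B p $ a * B p $ b) = (\<Sum>p<r. rank_one (B p))"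
    for r :: nat and B :: "nat \<Rightarrow> real^'n"
    by (simp add: rank_one_def vec_eq_iff)
  moreover have "(\<Sum>p<r. rank_one (B p)) \<in> sym_mats" for r :: nat and B :: "nat \<Rightarrow> real^'n"
    by (intro subspace_sum subspace_sym_mats rank_one_in_sym_mats)
  ultimately show ?thesis
    unfolding cp_mats_def by auto
qed

text \<open>Sums correspond to stacking the two factors, and a scalar \<open>c\<close> is absorbed by scaling the rows
  with its square root.\<close>

lemma convex_cone_cp_mats: "convex_cone cp_mats"
  unfolding convex_cone_iff
proof (intro conjI ballI allI impI)
  show "0 \<in> (cp_mats :: (real^'n^'n) set)"
    unfolding mem_cp_mats_iff by (intro exI [of _ "0::nat"]) simp
next
  fix X Y :: "real^'n^'n"
  assume "X \<in> cp_mats" "Y \<in> cp_mats"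
  then obtain r s :: nat and B D where
    B: "\<forall>p<r. \<forall>a. 0 \<le> B p $ a" "X = (\<Sum>p<r. rank_one (B p))" and
    D: "\<forall>p<s. \<forall>a. 0 \<le> D p $ a" "Y = (\<Sum>p<s. rank_one (D p))"
    unfolding mem_cp_mats_iff by auto
  define H where "H p = (if p < r then B p else D (p - r))" for p
  have "(\<Sum>p<r + s. rank_one (H p)) = (\<Sum>p<r. rank_one (H p)) + (\<Sum>p<s. rank_one (H (r + p)))"
    by (induction s) simp_all
  then have "X + Y = (\<Sum>p<r + s. rank_one (H p))"
    by (simp add: B D H_def)
  moreover have "\<forall>p<r + s. \<forall>a. 0 \<le> H p $ a"
    using B D by (auto simp: H_def)
  ultimately show "X + Y \<in> cp_mats"
    unfolding mem_cp_mats_iff by blast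
next
  fix X :: "real^'n^'n" and c :: real
  assume "X \<in> cp_mats" and c: "0 \<le> c"
  then obtain r :: nat and B where
    B: "\<forall>p<r. \<forall>a. 0 \<le> B p $ a" "X = (\<Sum>p<r. rank_one (B p))"
    unfolding mem_cp_mats_iff by auto
  have "c *\<^sub>R X = (\<Sum>p<r. rank_one (sqrt c *\<^sub>R B p))"
    using c by (simp add: B rank_one_scaleR scaleR_right.sum)
  moreover have "\<forall>p<r. \<forall>a. 0 \<le> (sqrt c *\<^sub>R B p) $ a"
    using B c by simp
  ultimately show "c *\<^sub>R X \<in> cp_mats"
    unfolding mem_cp_mats_iff by (intro exI conjI)
qed

lemma rank_one_mem_cp_mats:
  assumes "\<And>a. 0 \<le> x $ a"
  shows "rank_one x \<in> cp_mats"
  unfolding mem_cp_mats_iff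
  using assms by (intro exI [of _ "1::nat"] exI [of _ "\<lambda>_. x"]) simp

text \<open>A nonnegative row differs from a point of the simplex by a positive factor, unless it is zero.\<close>

lemma cp_mats_eq_hull: "cp_mats = convex_cone hull (rank_one ` std_simplex)"
proof
  show "convex_cone hull (rank_one ` std_simplex) \<subseteq> (cp_mats :: (real^'n^'n) set)"
    by (intro hull_minimal convex_cone_cp_mats) (auto simp: std_simplex_def intro: rank_one_mem_cp_mats)
next
  let ?H = "convex_cone hull (rank_one ` std_simplex) :: (real^'n^'n) set"
  have *: "rank_one v \<in> ?H" if "\<And>a. 0 \<le> v $ a" for v :: "real^'n"
  proof (cases "v = 0")
    case True
    then have "rank_one v = 0" by (simp add: rank_one_def vec_eq_iff)
    then show ?thesis by (simp add: convex_cone_hull_contains_0)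
  next
    case False
    define s where "s = (\<Sum>a\<in>UNIV. v $ a)"
    have "s > 0"
      using False that unfolding s_def
      by (metis (full_types) UNIV_I finite order_less_le sum_nonneg sum_nonneg_eq_0_iff vec_eq_iff zero_index)
    then have "(1 / s) *\<^sub>R v \<in> std_simplex"
      using that by (simp add: std_simplex_def s_def flip: sum_divide_distrib)
    moreover have "rank_one v = s\<^sup>2 *\<^sub>R rank_one ((1 / s) *\<^sub>R v)"
      using \<open>s > 0\<close> by (simp flip: rank_one_scaleR)
    ultimately show ?thesis
      by (simp add: convex_cone_hull_mul hull_inc)
  qed
  show "cp_mats \<subseteq> ?H"
  proof
    fix X :: "real^'n^'n"
    assume "X \<in> cp_mats"
    then obtain r :: nat and B where "\<forall>p<r. \<forall>a. 0 \<le> B p $ a" "X = (\<Sum>p<r. rank_one (B p))"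
      unfolding mem_cp_mats_iff by auto
    then show "X \<in> ?H"
      by (auto intro!: convex_cone_sum convex_cone_convex_cone_hull *)
  qed
qed

text \<open>The sum of all entries, written as the trace of the product with the all-ones matrix, equals 1
  on rank-one matrices of points of the simplex. So the compact set \<open>convex hull (rank_one ` S)\<close>
  misses the origin, and the cone over a compact set that misses the origin is closed.\<close>

lemma closed_hull_rank_one:
  fixes S :: "(real^'n) set"
  assumes S: "compact S" "S \<subseteq> std_simplex"
  shows "closed (convex_cone hull (rank_one ` S))"
proof (cases "S = {}")
  case False
  let ?J = "\<chi> a b. 1 :: real^'n^'n"
  have "trace (?J ** rank_one x) = 1" if "x \<in> S" for x
  proof -
    have "trace (?J ** rank_one x) = (\<Sum>a\<in>UNIV. x $ a) * (\<Sum>b\<in>UNIV. x $ b)"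
      by (simp add: trace_mult_eq rank_one_def sum_product mult.commute)
    then show ?thesis
      using that S by (auto simp: std_simplex_def)
  qed
  moreover have "convex {X. trace (?J ** X) = 1}"
    using convex_linear_vimage [OF linear_trace_right, of "{1}" ?J] by (simp add: vimage_def)
  ultimately have "convex hull (rank_one ` S) \<subseteq> {X. trace (?J ** X) = 1}"
    by (intro hull_minimal) auto
  moreover have "trace (?J ** 0) = 0"
    by (rule linear_0 [OF linear_trace_right])
  ultimately have "0 \<notin> convex hull (rank_one ` S)"
    by auto
  moreover have "compact (convex hull (rank_one ` S))"
    by (intro compact_convex_hull compact_continuous_image continuous_rank_one S)
  ultimately show ?thesis
    using False by (simp add: convex_cone_hull_separate_nonempty closed_conic_hull)
qed simp

lemma std_simplex_norm_le_1:
  fixes x :: "real^'n"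
  assumes "x \<in> std_simplex"
  shows "norm x \<le> 1"
  using norm_le_l1_cart [of x] assms by (simp add: std_simplex_def)

lemma compact_std_simplex: "compact (std_simplex :: (real^'n) set)"
proof -
  have "bounded (std_simplex :: (real^'n) set)"
    unfolding bounded_iff using std_simplex_norm_le_1 by blast
  moreover have "closed (std_simplex :: (real^'n) set)"
    unfolding std_simplex_def
    by (intro closed_Collect_conj closed_Collect_all closed_Collect_le closed_Collect_eq continuous_intros)
  ultimately show ?thesis
    by (simp add: compact_eq_bounded_closed)
qed

lemma convex_std_simplex: "convex (std_simplex :: (real^'n) set)"
  unfolding convex_def std_simplex_def
  by (auto simp: sum.distrib simp flip: sum_distrib_left)

lemma closed_cp_mats: "closed (cp_mats :: (real^'n^'n) set)"
  by (simp add: cp_mats_eq_hull closed_hull_rank_one compact_std_simplex)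

text \<open>The affine hull of \<open>K\<close> may be smaller than the space of symmetric matrices, so a neighbourhood
  in that space restricts to a neighbourhood in the affine hull.\<close>

lemma sym_interior_subset_rel_interior:
  assumes "K \<subseteq> sym_mats"
  shows "sym_interior K \<subseteq> rel_interior K"
proof
  fix X
  assume "X \<in> sym_interior K"
  then obtain T where T: "openin (top_of_set sym_mats) T" "X \<in> T" "T \<subseteq> K"
    unfolding sym_interior_def interior_of_def by blast
  obtain V where V: "open V" "T = sym_mats \<inter> V"
    using T by (auto simp: openin_open)
  moreover have "affine hull K \<subseteq> sym_mats"
    by (intro hull_minimal assms subspace_imp_affine subspace_sym_mats)
  ultimately show "X \<in> rel_interior K"
    using T unfolding mem_rel_interior by blast
qed

section \<open>Coercivity of interior copositive matrices\<close>

text \<open>On matrices with nonnegative entries the entrywise sum is the \<open>\<ell>\<^sub>1\<close> norm.\<close>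

lemma norm_le_trace_ones:
  fixes X :: "real^'n^'n"
  assumes "X \<in> cp_mats"
  shows "norm X \<le> trace ((\<chi> a b. 1) ** X)"
proof -
  have nonneg: "0 \<le> X $ a $ b" for a b
    using assms by (auto simp: mem_cp_mats_iff rank_one_def intro!: sum_nonneg)
  have "norm X \<le> (\<Sum>a\<in>UNIV. norm (X $ a))"
    by (simp add: norm_vec_def L2_set_le_sum)
  also have "\<dots> \<le> (\<Sum>a\<in>UNIV. \<Sum>b\<in>UNIV. X $ a $ b)"
  proof (rule sum_mono)
    show "norm (X $ a) \<le> (\<Sum>b\<in>UNIV. X $ a $ b)" for a
      using norm_le_l1_cart [of "X $ a"] by (simp add: nonneg)
  qed
  also have "\<dots> = trace ((\<chi> a b. 1) ** X)"
    by (simp add: trace_mult_eq) (rule sum.swap)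
  finally show ?thesis .
qed

text \<open>On a rank-one matrix the pairing is the value of the quadratic form of \<open>Z\<close>; the condition then
  passes to the convex cone that these matrices generate.\<close>

lemma copositive_pairing:
  assumes "Z \<in> cop_mats" "X \<in> cp_mats"
  shows "0 \<le> trace (Z ** X)"
proof -
  have "cp_mats \<subseteq> {X. 0 \<le> trace (Z ** X)}"
    unfolding cp_mats_eq_hull
  proof (rule hull_minimal)
    show "rank_one ` std_simplex \<subseteq> {X. 0 \<le> trace (Z ** X)}"
      using assms(1) by (auto simp: trace_rank_one cop_mats_def std_simplex_def)
    show "convex_cone {X. 0 \<le> trace (Z ** X)}"
      using linear_0 [OF linear_trace_right, of Z]
      by (simp add: convex_cone_iff linear_add [OF linear_trace_right] linear_cmul [OF linear_trace_right])
  qed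
  with assms show ?thesis by blast
qed

text \<open>If \<open>Z\<close> is interior, then \<open>Z - e J\<close> is still copositive for the all-ones matrix \<open>J\<close> and a small
  \<open>e > 0\<close>. Pairing with \<open>X\<close> bounds the trace from below by \<open>e\<close> times the entrywise sum of \<open>X\<close>,
  hence by \<open>e\<close> times its norm.\<close>

lemma interior_copositive_coercive:
  fixes Z :: "real^'n^'n"
  assumes "Z \<in> sym_interior cop_mats"
  obtains e where "e > 0" "\<And>X. X \<in> cp_mats \<Longrightarrow> e * norm X \<le> trace (Z ** X)"
proof -
  define J :: "real^'n^'n" where "J = (\<chi> a b. 1)"
  have J: "J \<in> sym_mats"
    by (simp add: J_def sym_mats_def transpose_def)
  obtain T where T: "openin (top_of_set sym_mats) T" "Z \<in> T" "T \<subseteq> cop_mats"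
    using assms unfolding sym_interior_def interior_of_def by blast
  then obtain V where V: "open V" "T = sym_mats \<inter> V"
    by (auto simp: openin_open)
  have "((\<lambda>e. Z - e *\<^sub>R J) \<longlongrightarrow> Z - 0 *\<^sub>R J) (at_right 0)"
    by (intro tendsto_intros)
  then have "\<forall>\<^sub>F e in at_right 0. Z - e *\<^sub>R J \<in> V"
    using T V by (intro topological_tendstoD) auto
  moreover have "\<forall>\<^sub>F e in at_right (0::real). e > 0"
    by (simp add: eventually_at_right_less)
  ultimately have "\<forall>\<^sub>F e in at_right 0. e > 0 \<and> Z - e *\<^sub>R J \<in> V"
    by eventually_elim simp
  then obtain e where e: "e > 0" "Z - e *\<^sub>R J \<in> V"
    using eventually_happens' [OF trivial_limit_at_right_real] by blast
  have "Z - e *\<^sub>R J \<in> sym_mats"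
    using T V J by (intro subspace_diff subspace_scale subspace_sym_mats) auto
  then have cop: "Z - e *\<^sub>R J \<in> cop_mats"
    using e T V by auto
  have "e * norm X \<le> trace (Z ** X)" if "X \<in> cp_mats" for X
  proof -
    have "0 \<le> trace ((Z - e *\<^sub>R J) ** X)"
      using copositive_pairing cop that by blast
    also have "\<dots> = trace (Z ** X) - e * trace (J ** X)"
      by (simp add: linear_diff [OF linear_trace_left] linear_cmul [OF linear_trace_left])
    also have "\<dots> \<le> trace (Z ** X) - e * norm X"
      using norm_le_trace_ones [OF that] e by (simp add: J_def)
    finally show ?thesis by simp
  qed
  with e that show thesis by blast
qed

section \<open>The cones of scaled diagonally dominant matrices\<close>

text \<open>The off-diagonal position is the only one that needs a sign condition, since the diagonal of a
  positive semidefinite matrix is nonnegative anyway.\<close>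

definition nonneg_psd2 :: "(real^2^2) set" where
  "nonneg_psd2 = {S \<in> psd_mats. 0 \<le> S $ 1 $ 2}"

lemma psd_mats_2_iff:
  fixes S :: "real^2^2"
  shows "S \<in> psd_mats \<longleftrightarrow>
    S $ 2 $ 1 = S $ 1 $ 2 \<and>
    (\<forall>x y. 0 \<le> S $ 1 $ 1 * x\<^sup>2 + 2 * (S $ 1 $ 2 * x * y) + S $ 2 $ 2 * y\<^sup>2)"
proof -
  have sym: "S \<in> sym_mats \<longleftrightarrow> S $ 2 $ 1 = S $ 1 $ 2"
    by (auto simp: sym_mats_def transpose_def vec_eq_iff forall_2)
  have "v \<bullet> (S *v v) = S $ 1 $ 1 * (v $ 1)\<^sup>2 + 2 * (S $ 1 $ 2 * v $ 1 * v $ 2) + S $ 2 $ 2 * (v $ 2)\<^sup>2"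
    if "S $ 2 $ 1 = S $ 1 $ 2" for v
    using that by (simp add: inner_vec_def matrix_vector_mult_def sum_2 algebra_simps power2_eq_square)
  moreover have "(\<forall>v :: real^2. Q (v $ 1) (v $ 2)) \<longleftrightarrow> (\<forall>x y. Q x y)" for Q
    by (metis vector_2)
  ultimately show ?thesis
    unfolding psd_mats_def mem_Collect_eq sym
    by (metis (mono_tags, lifting) vector_2)
qed

lemma convex_cone_psd_mats: "convex_cone psd_mats"
  unfolding convex_cone_iff psd_mats_def
  by (auto simp: matrix_vector_mult_add_rdistrib inner_add_right
      simp flip: scaleR_matrix_vector_assoc
      intro: subspace_0 subspace_add subspace_scale subspace_sym_mats)

lemma convex_cone_nonneg_psd2: "convex_cone nonneg_psd2"
  using convex_cone_psd_mats unfolding convex_cone_iff nonneg_psd2_def by auto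

text \<open>This is a Cholesky factorization \<open>S = w w\<^sup>T + z z\<^sup>T\<close> with the nonnegative vectors \<open>w = (p, q)\<close>
  and \<open>z = (0, r)\<close>: in order two, positive semidefinite and entrywise nonnegative implies
  completely positive.\<close>

lemma nonneg_psd2_factorization:
  assumes "S \<in> nonneg_psd2"
  obtains p q r where "0 \<le> p" "0 \<le> q" "0 \<le> r"
    "S $ 1 $ 1 = p\<^sup>2" "S $ 1 $ 2 = p * q" "S $ 2 $ 1 = p * q" "S $ 2 $ 2 = q\<^sup>2 + r\<^sup>2"
proof -
  define a b c where "a = S $ 1 $ 1" and "b = S $ 1 $ 2" and "c = S $ 2 $ 2"
  have S21: "S $ 2 $ 1 = b" and b: "0 \<le> b"
    and form: "0 \<le> a * x\<^sup>2 + 2 * (b * x * y) + c * y\<^sup>2" for x y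
    using assms by (auto simp: nonneg_psd2_def psd_mats_2_iff a_def b_def c_def)
  have a: "0 \<le> a" and c: "0 \<le> c"
    using form [of 1 0] form [of 0 1] by auto
  show thesis
  proof (cases "a = 0")
    case True
    have "b = 0"
    proof (rule ccontr)
      assume "b \<noteq> 0"
      then show False
        \<comment> \<open>The form is affine in its first argument here, and this argument gives it the value -1.\<close>
        using form [of "- (c + 1) / (2 * b)" 1] True
        by (simp add: field_simps)
    qed
    show thesis
      by (rule that [of 0 0 "sqrt c"])
        (use True \<open>b = 0\<close> S21 c in \<open>simp_all flip: a_def b_def c_def\<close>)
  next
    case False
    then have "a > 0" using a by simp
    have "0 \<le> a * (a * c - b\<^sup>2)"
      \<comment> \<open>The vector \<open>(-b, a)\<close> turns the form into \<open>a\<close> times the determinant.\<close>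
      using form [of "- b" a] by (simp add: algebra_simps power2_eq_square)
    then have "0 \<le> a * c - b\<^sup>2"
      using \<open>a > 0\<close> by (simp add: zero_le_mult_iff)
    then have "0 \<le> c - b\<^sup>2 / a"
      using \<open>a > 0\<close> by (simp add: field_simps)
    then show thesis
      by (intro that [of "sqrt a" "b / sqrt a" "sqrt (c - b\<^sup>2 / a)"])
        (use \<open>a > 0\<close> S21 b in \<open>simp_all add: power_divide flip: a_def b_def c_def\<close>)
  qed
qed

lemma iota_nonneg:
  assumes "S \<in> nonneg_psd2"
  shows "0 \<le> iota i j S p q"
proof -
  obtain x y z where "0 \<le> x" "0 \<le> y" "0 \<le> z" "S $ 1 $ 1 = x\<^sup>2"
    "S $ 1 $ 2 = x * y" "S $ 2 $ 1 = x * y" "S $ 2 $ 2 = y\<^sup>2 + z\<^sup>2"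
    using nonneg_psd2_factorization [OF assms] .
  then have "0 \<le> S $ 1 $ 1" "0 \<le> S $ 1 $ 2" "0 \<le> S $ 2 $ 1" "0 \<le> S $ 2 $ 2"
    by simp_all
  then show ?thesis
    unfolding iota_def by (smt (verit))
qed

text \<open>This is \<open>W\<^sup>T S W\<close> for the matrix \<open>W\<close> with the two rows \<open>u\<close> and \<open>v\<close>: the contribution of one
  edge with end points \<open>u\<close>, \<open>v\<close> to an element of the scaled diagonally dominant cone.\<close>

definition edge_mat :: "real^'n \<Rightarrow> real^'n \<Rightarrow> real^2^2 \<Rightarrow> real^'n^'n" where
  "edge_mat u v S = (\<chi> a b. u $ a * S $ 1 $ 1 * u $ b + u $ a * S $ 1 $ 2 * v $ b +
     v $ a * S $ 2 $ 1 * u $ b + v $ a * S $ 2 $ 2 * v $ b)"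

lemma linear_edge_mat: "linear (edge_mat u v)"
  by (rule linearI) (simp_all add: edge_mat_def vec_eq_iff algebra_simps)

lemma iota_congruence:
  fixes U :: "nat \<Rightarrow> real^'n"
  assumes "i \<in> {1..t}" "j \<in> {1..t}" "i \<noteq> j"
  shows "(\<Sum>p=1..t. \<Sum>q=1..t. U p $ a * iota i j S p q * U q $ b) = edge_mat (U i) (U j) S $ a $ b"
proof -
  have "U p $ a * iota i j S p q * U q $ b =
      (if q = i then if p = i then U i $ a * S $ 1 $ 1 * U i $ b else 0 else 0) +
      (if q = j then if p = i then U i $ a * S $ 1 $ 2 * U j $ b else 0 else 0) +
      (if q = i then if p = j then U j $ a * S $ 2 $ 1 * U i $ b else 0 else 0) +
      (if q = j then if p = j then U j $ a * S $ 2 $ 2 * U j $ b else 0 else 0)" for p q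
    using assms by (auto simp: iota_def)
  then show ?thesis
    using assms by (simp add: sum.distrib sum.delta edge_mat_def)
qed

abbreviation edge_pairs :: "nat set set \<Rightarrow> (nat \<times> nat) set" where
  "edge_pairs E \<equiv> {(i, j). i < j \<and> {i, j} \<in> E}"

lemma edge_pairs_subset:
  assumes "simple_graph t E"
  shows "edge_pairs E \<subseteq> {1..t} \<times> {1..t}"
  using assms by (fastforce simp: simple_graph_def)

lemma finite_edge_pairs: "simple_graph t E \<Longrightarrow> finite (edge_pairs E)"
  using edge_pairs_subset finite_subset by blast

lemma congruence_iota_sum:
  fixes U :: "nat \<Rightarrow> real^'n"
  assumes G: "simple_graph t E"
  shows "(\<chi> a b. \<Sum>p=1..t. \<Sum>q=1..t. U p $ a * (\<Sum>(i, j)\<in>edge_pairs E. iota i j (S i j) p q) * U q $ b) =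
    (\<Sum>(i, j)\<in>edge_pairs E. edge_mat (U i) (U j) (S i j))"
proof -
  let ?P = "edge_pairs E"
  have "(\<Sum>p=1..t. \<Sum>q=1..t. U p $ a * (\<Sum>(i, j)\<in>?P. iota i j (S i j) p q) * U q $ b) =
      (\<Sum>(i, j)\<in>?P. edge_mat (U i) (U j) (S i j)) $ a $ b" for a b
  proof -
    have "(\<Sum>p=1..t. \<Sum>q=1..t. U p $ a * (\<Sum>(i, j)\<in>?P. iota i j (S i j) p q) * U q $ b) =
        (\<Sum>p=1..t. \<Sum>q=1..t. \<Sum>(i, j)\<in>?P. U p $ a * iota i j (S i j) p q * U q $ b)"
      by (simp add: sum_distrib_left sum_distrib_right case_prod_unfold)
    also have "\<dots> = (\<Sum>p=1..t. \<Sum>(i, j)\<in>?P. \<Sum>q=1..t. U p $ a * iota i j (S i j) p q * U q $ b)"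
      unfolding case_prod_unfold by (intro sum.cong refl sum.swap)
    also have "\<dots> = (\<Sum>(i, j)\<in>?P. \<Sum>p=1..t. \<Sum>q=1..t. U p $ a * iota i j (S i j) p q * U q $ b)"
      unfolding case_prod_unfold by (rule sum.swap)
    also have "\<dots> = (\<Sum>(i, j)\<in>?P. edge_mat (U i) (U j) (S i j) $ a $ b)"
    proof (intro sum.cong refl, clarify)
      fix i j
      assume "i < j" "{i, j} \<in> E"
      then show "(\<Sum>p=1..t. \<Sum>q=1..t. U p $ a * iota i j (S i j) p q * U q $ b) =
          edge_mat (U i) (U j) (S i j) $ a $ b"
        using edge_pairs_subset [OF G] by (intro iota_congruence) auto
    qed
    finally show ?thesis
      by (simp add: case_prod_unfold)
  qed
  then show ?thesis
    by (simp add: vec_eq_iff)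
qed

text \<open>Entrywise nonnegativity of the sum \<open>Y\<close> can be read off edge by edge: the entry of \<open>Y\<close> at an edge
  \<open>(i, j)\<close> is the off-diagonal entry of the one summand that belongs to this edge. So the sign
  condition on \<open>Y\<close> becomes a condition on the summands.\<close>

lemma sdd_cone_explicit:
  fixes U :: "nat \<Rightarrow> real^'n"
  assumes G: "simple_graph t E"
  shows "sdd_cone t E U =
    {\<Sum>(i, j)\<in>edge_pairs E. edge_mat (U i) (U j) (S i j) | S.
       \<forall>(i, j)\<in>edge_pairs E. S i j \<in> nonneg_psd2}" (is "_ = ?R")
proof
  show "sdd_cone t E U \<subseteq> ?R"
  proof
    fix X
    assume "X \<in> sdd_cone t E U"
    then obtain Y where Y: "Y \<in> sdd_nonneg t E"
      and X: "X = (\<chi> a b. \<Sum>p=1..t. \<Sum>q=1..t. U p $ a * Y p q * U q $ b)"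
      unfolding sdd_cone_def by blast
    obtain S where psd: "\<And>i j. i < j \<Longrightarrow> {i, j} \<in> E \<Longrightarrow> S i j \<in> psd_mats"
      and S: "Y = (\<lambda>p q. \<Sum>(i, j)\<in>edge_pairs E. iota i j (S i j) p q)"
      using Y unfolding sdd_nonneg_def sdd_def by blast
    have "S i j \<in> nonneg_psd2" if ij: "(i, j) \<in> edge_pairs E" for i j
    proof -
      have "Y i j = (\<Sum>e\<in>edge_pairs E. if e = (i, j) then S i j $ 1 $ 2 else 0)"
        unfolding S using ij by (intro sum.cong refl) (auto simp: iota_def split: if_splits)
      also have "\<dots> = S i j $ 1 $ 2"
        using ij finite_edge_pairs [OF G] by simp
      finally have "Y i j = S i j $ 1 $ 2" .
      moreover have "i \<in> {1..t}" "j \<in> {1..t}"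
        using subsetD [OF edge_pairs_subset [OF G] ij] by auto
      then have "0 \<le> Y i j"
        using Y unfolding sdd_nonneg_def by blast
      ultimately have "0 \<le> S i j $ 1 $ 2"
        by simp
      with psd ij show ?thesis
        by (simp add: nonneg_psd2_def)
    qed
    moreover have "X = (\<Sum>(i, j)\<in>edge_pairs E. edge_mat (U i) (U j) (S i j))"
      unfolding X S by (rule congruence_iota_sum [OF G])
    ultimately show "X \<in> ?R"
      by blast
  qed
  show "?R \<subseteq> sdd_cone t E U"
  proof
    fix X
    assume "X \<in> ?R"
    then obtain S where S: "\<And>i j. (i, j) \<in> edge_pairs E \<Longrightarrow> S i j \<in> nonneg_psd2"
      and X: "X = (\<Sum>(i, j)\<in>edge_pairs E. edge_mat (U i) (U j) (S i j))"
      by blast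
    define Y where "Y = (\<lambda>p q. \<Sum>(i, j)\<in>edge_pairs E. iota i j (S i j) p q)"
    have "0 \<le> iota i j (S i j) p q" if "(i, j) \<in> edge_pairs E" for i j p q
      by (rule iota_nonneg [OF S [OF that]])
    then have "0 \<le> Y p q" for p q
      unfolding Y_def by (intro sum_nonneg) auto
    moreover have "Y \<in> sdd E"
      unfolding sdd_def Y_def using S by (auto simp: nonneg_psd2_def)
    ultimately have "Y \<in> sdd_nonneg t E"
      by (simp add: sdd_nonneg_def)
    moreover have "X = (\<chi> a b. \<Sum>p=1..t. \<Sum>q=1..t. U p $ a * Y p q * U q $ b)"
      unfolding X Y_def by (rule congruence_iota_sum [OF G, symmetric])
    ultimately show "X \<in> sdd_cone t E U"
      unfolding sdd_cone_def by blast
  qed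
qed

lemma convex_cone_sdd_cone:
  assumes G: "simple_graph t E"
  shows "convex_cone (sdd_cone t E U)"
proof -
  let ?F = "\<lambda>S. \<Sum>(i, j)\<in>edge_pairs E. edge_mat (U i) (U j) (S i j)"
  let ?ok = "\<lambda>S. \<forall>(i, j)\<in>edge_pairs E. S i j \<in> nonneg_psd2"
  have memI: "?F S \<in> sdd_cone t E U" if "?ok S" for S
    unfolding sdd_cone_explicit [OF G] using that by blast
  have memE: "\<exists>S. ?ok S \<and> X = ?F S" if "X \<in> sdd_cone t E U" for X
    using that unfolding sdd_cone_explicit [OF G] by blast
  show ?thesis
    unfolding convex_cone_iff
  proof (intro conjI ballI allI impI)
    have "0 = ?F (\<lambda>_ _. 0)"
      by (simp add: linear_0 [OF linear_edge_mat] case_prod_unfold)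
    also have "\<dots> \<in> sdd_cone t E U"
      by (intro memI) (auto intro: convex_cone_contains_0 convex_cone_nonneg_psd2)
    finally show "0 \<in> sdd_cone t E U" .
  next
    fix X Y
    assume "X \<in> sdd_cone t E U" "Y \<in> sdd_cone t E U"
    then obtain S T where S: "?ok S" "X = ?F S" and T: "?ok T" "Y = ?F T"
      using memE by meson
    have "X + Y = ?F (\<lambda>i j. S i j + T i j)"
      by (simp add: S T linear_add [OF linear_edge_mat] case_prod_unfold sum.distrib)
    also have "\<dots> \<in> sdd_cone t E U"
      using S T by (intro memI) (auto intro: convex_cone_add convex_cone_nonneg_psd2)
    finally show "X + Y \<in> sdd_cone t E U" .
  next
    fix X and c :: real
    assume "X \<in> sdd_cone t E U" and c: "0 \<le> c"
    then obtain S where S: "?ok S" "X = ?F S"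
      using memE by meson
    have "c *\<^sub>R X = ?F (\<lambda>i j. c *\<^sub>R S i j)"
      by (simp add: S linear_cmul [OF linear_edge_mat] case_prod_unfold scaleR_right.sum)
    also have "\<dots> \<in> sdd_cone t E U"
      using S c by (intro memI) (auto intro: convex_cone_scaleR convex_cone_nonneg_psd2)
    finally show "c *\<^sub>R X \<in> sdd_cone t E U" .
  qed
qed

text \<open>One inclusion writes each block as \<open>w w\<^sup>T + z z\<^sup>T\<close> with \<open>w, z \<ge> 0\<close>, which turns the edge matrix into
  rank-one matrices of nonnegative combinations of \<open>U i\<close> and \<open>U j\<close>. Conversely, the point
  \<open>(1 - c) U i + c U j\<close> comes from the block \<open>w w\<^sup>T\<close> with \<open>w = (1 - c, c)\<close>.\<close>

lemma sdd_cone_eq_hull: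
  fixes U :: "nat \<Rightarrow> real^'n"
  assumes G: "simple_graph t E"
  shows "sdd_cone t E U = convex_cone hull (rank_one ` seg E U)"
proof
  let ?H = "convex_cone hull (rank_one ` seg E U)"
  have edge: "edge_mat (U i) (U j) S \<in> ?H" if ij: "{i, j} \<in> E" and S: "S \<in> nonneg_psd2" for i j S
  proof -
    obtain p q r where pqr: "0 \<le> p" "0 \<le> q" "0 \<le> r"
      "S $ 1 $ 1 = p\<^sup>2" "S $ 1 $ 2 = p * q" "S $ 2 $ 1 = p * q" "S $ 2 $ 2 = q\<^sup>2 + r\<^sup>2"
      using nonneg_psd2_factorization [OF S] by blast
    have seg: "rank_one x \<in> ?H" if "x \<in> closed_segment (U i) (U j)" for x
      using that \<open>{i, j} \<in> E\<close> by (intro hull_inc imageI) (auto simp: seg_def)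
    have "edge_mat (U i) (U j) S =
        rank_one (p *\<^sub>R U i + q *\<^sub>R U j) + rank_one (0 *\<^sub>R U i + r *\<^sub>R U j)"
      by (simp add: edge_mat_def rank_one_def vec_eq_iff pqr algebra_simps power2_eq_square)
    then show ?thesis
      using rank_one_nonneg_combination_mem [OF convex_cone_convex_cone_hull seg] pqr
      by (simp only: convex_cone_hull_add order_refl)
  qed
  show "sdd_cone t E U \<subseteq> ?H"
    unfolding sdd_cone_explicit [OF G]
    by (auto intro!: convex_cone_sum convex_cone_convex_cone_hull edge)
  show "?H \<subseteq> sdd_cone t E U"
  proof (rule hull_minimal)
    show "convex_cone (sdd_cone t E U)"
      by (rule convex_cone_sdd_cone [OF G])
    show "rank_one ` seg E U \<subseteq> sdd_cone t E U"
    proof clarify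
      fix x
      assume "x \<in> seg E U"
      then obtain i' j' where "{i', j'} \<in> E" "x \<in> closed_segment (U i') (U j')"
        unfolding seg_def by blast
      moreover from this have "i' \<noteq> j'"
        using G by (auto simp: simple_graph_def)
      ultimately obtain i j where ij: "i < j" "{i, j} \<in> E" "x \<in> closed_segment (U i) (U j)"
        by (metis closed_segment_commute insert_commute nat_neq_iff)
      then obtain c where c: "0 \<le> c" "c \<le> 1" "x = (1 - c) *\<^sub>R U i + c *\<^sub>R U j"
        unfolding closed_segment_def by blast
      define W where "W = rank_one (vector [1 - c, c] :: real^2)"
      define S where "S = (\<lambda>k l. if (k, l) = (i, j) then W else 0)"
      have "0 \<le> v \<bullet> (W *v v)" for v
      proof -
        have "v \<bullet> (W *v v) = ((1 - c) * v $ 1 + c * v $ 2)\<^sup>2"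
          by (simp add: W_def rank_one_def inner_vec_def matrix_vector_mult_def sum_2
              power2_eq_square algebra_simps)
        then show ?thesis by simp
      qed
      then have "W \<in> nonneg_psd2"
        using c rank_one_in_sym_mats by (simp add: nonneg_psd2_def psd_mats_def W_def rank_one_def)
      then have "\<forall>(k, l)\<in>edge_pairs E. S k l \<in> nonneg_psd2"
        using convex_cone_contains_0 [OF convex_cone_nonneg_psd2] by (auto simp: S_def)
      moreover have "rank_one x = (\<Sum>(k, l)\<in>edge_pairs E. edge_mat (U k) (U l) (S k l))"
      proof -
        have "(\<Sum>(k, l)\<in>edge_pairs E. edge_mat (U k) (U l) (S k l)) =
            (\<Sum>e\<in>edge_pairs E. if e = (i, j) then edge_mat (U i) (U j) W else 0)"
          by (intro sum.cong) (auto simp: S_def linear_0 [OF linear_edge_mat] split: if_splits)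
        also have "\<dots> = edge_mat (U i) (U j) W"
          using ij finite_edge_pairs [OF G] by simp
        also have "\<dots> = rank_one x"
          by (simp add: c edge_mat_def W_def rank_one_def vec_eq_iff algebra_simps)
        finally show ?thesis by simp
      qed
      ultimately show "rank_one x \<in> sdd_cone t E U"
        unfolding sdd_cone_explicit [OF G] by blast
    qed
  qed
qed

section \<open>Minimization over inner approximations of a convex set\<close>

abbreviation minimizers :: "('a \<Rightarrow> real) \<Rightarrow> 'a set \<Rightarrow> 'a set" where
  "minimizers f S \<equiv> {x \<in> S. \<forall>z\<in>S. f x \<le> f z}"

lemma minimizers_nonempty_coercive:
  fixes f :: "'a::heine_borel \<Rightarrow> real"
  assumes "closed S" "S \<noteq> {}" "continuous_on UNIV f"
    and bounded: "\<And>c. bounded {x \<in> S. f x \<le> c}"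
  shows "minimizers f S \<noteq> {}"
proof -
  obtain x0 where x0: "x0 \<in> S"
    using assms by blast
  let ?T = "S \<inter> {x. f x \<le> f x0}"
  have "closed ?T"
    using assms by (intro closed_Int closed_Collect_le continuous_intros)
  then have "compact ?T"
    using bounded [of "f x0"] by (simp add: compact_eq_bounded_closed Int_def)
  then obtain x where "x \<in> ?T" "\<forall>z\<in>?T. f x \<le> f z"
    using continuous_attains_inf [of ?T f] x0 continuous_on_subset [OF assms(3)] by blast
  moreover have "f x \<le> f z" if "z \<in> S" "x \<in> ?T" "\<forall>z\<in>?T. f x \<le> f z" for x z
    using that by (cases "f z \<le> f x0") auto
  ultimately have "x \<in> minimizers f S"
    by blast
  then show ?thesis
    by blast
qed

text \<open>Convex sets with the same closure have the same relative interior. This makes every strictly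
  feasible point feasible for the inner approximations from some index on.\<close>

lemma rel_interior_subset_dense_convex_subset:
  fixes L :: "'a::euclidean_space set"
  assumes "convex U" "convex L" and sub: "U \<subseteq> L" and dense: "L \<subseteq> closure U"
  shows "rel_interior L \<subseteq> U"
proof -
  have "closure U = closure L"
    using closure_mono [OF sub] closure_minimal [OF dense] by auto
  then have "rel_interior U = rel_interior L"
    using assms(1,2) convex_same_rel_interior_closure by blast
  then show ?thesis
    using rel_interior_subset by blast
qed

text \<open>A feasible \<open>x\<close> need not belong to any \<open>K k\<close>. Moving it slightly towards the relative interior point
  \<open>x0\<close> keeps the affine constraints, enters the relative interior and changes the objective little.\<close>

lemma near_optimal_point_in_approximation:
  fixes K :: "nat \<Rightarrow> 'a::euclidean_space set" and f :: "'a \<Rightarrow> real"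
  assumes "convex L" "affine M" "continuous_on UNIV f"
    and inner: "rel_interior L \<subseteq> (\<Union>k. K k)"
    and x0: "x0 \<in> rel_interior L \<inter> M"
    and x: "x \<in> L \<inter> M" and "e > 0"
  obtains k z where "z \<in> K k \<inter> M" "f z < f x + e"
proof -
  define p where "p s = x - s *\<^sub>R (x - x0)" for s :: real
  have p_M: "p s \<in> M" for s
    using mem_affine [OF \<open>affine M\<close>, of x x0 "1 - s" s] x x0 by (simp add: p_def algebra_simps)
  have p_L: "p s \<in> rel_interior L" if "0 < s" "s \<le> 1" for s
    using rel_interior_convex_shrink [OF \<open>convex L\<close>] that x x0 by (simp add: p_def)
  have "((\<lambda>s. p s) \<longlongrightarrow> x - 0 *\<^sub>R (x - x0)) (at_right 0)"
    unfolding p_def by (intro tendsto_intros)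
  moreover have "isCont f x"
    using assms(3) by (simp add: continuous_on_eq_continuous_at)
  ultimately have "((\<lambda>s. f (p s)) \<longlongrightarrow> f x) (at_right 0)"
    by (simp add: isCont_tendsto_compose)
  then have "\<forall>\<^sub>F s in at_right 0. f (p s) < f x + e"
    using \<open>e > 0\<close> by (intro order_tendstoD(2)) auto
  moreover have "\<forall>\<^sub>F s in at_right (0::real). s \<in> {0<..<1}"
    by (rule eventually_at_right_real) simp
  ultimately have "\<forall>\<^sub>F s in at_right 0. f (p s) < f x + e \<and> s \<in> {0<..<1}"
    by eventually_elim simp
  then obtain s where s: "f (p s) < f x + e" "0 < s" "s < 1"
    using eventually_happens' [OF trivial_limit_at_right_real] by fastforce
  then obtain k where "p s \<in> K k"
    using p_L [of s] inner by auto
  then show thesis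
    using that p_M s by blast
qed

text \<open>The values are at least \<open>f xs\<close>, since the approximations lie inside \<open>L\<close>. They are eventually below
  any \<open>c > f xs\<close>, since a near-optimal point of one approximation belongs to all later ones.\<close>

lemma minimal_values_converge:
  fixes K :: "nat \<Rightarrow> 'a::euclidean_space set" and f :: "'a \<Rightarrow> real"
  assumes K: "incseq K" "(\<Union>k. K k) \<subseteq> L" and "convex L" "affine M" "continuous_on UNIV f"
    and inner: "rel_interior L \<subseteq> (\<Union>k. K k)"
    and x0: "x0 \<in> rel_interior L \<inter> M"
    and xs: "xs \<in> minimizers f (L \<inter> M)"
    and x: "\<And>k. k \<ge> k0 \<Longrightarrow> x k \<in> minimizers f (K k \<inter> M)"
  shows "(\<lambda>k. f (x k)) \<longlonglongrightarrow> f xs"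
proof (rule order_tendstoI)
  fix c
  assume "c < f xs"
  have "f xs \<le> f (x k)" if "k \<ge> k0" for k
    using x [OF that] xs K by blast
  then show "\<forall>\<^sub>F k in sequentially. c < f (x k)"
    using \<open>c < f xs\<close> unfolding eventually_sequentially by (meson less_le_trans)
next
  fix c
  assume "f xs < c"
  then have "0 < c - f xs" and "xs \<in> L \<inter> M"
    using xs by auto
  then obtain k1 z where z: "z \<in> K k1 \<inter> M" "f z < f xs + (c - f xs)"
    using near_optimal_point_in_approximation [OF assms(3-5) inner x0] by metis
  have "f (x k) < c" if "k \<ge> max k0 k1" for k
  proof -
    have "z \<in> K k \<inter> M"
      using z incseqD [OF K(1), of k1 k] that by auto
    then have "f (x k) \<le> f z"
      using x [of k] that by auto
    then show ?thesis
      using z by simp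
  qed
  then show "\<forall>\<^sub>F k in sequentially. f (x k) < c"
    unfolding eventually_sequentially by blast
qed

section \<open>Dense unions of segments\<close>

lemma seg_subset_std_simplex:
  assumes "simple_graph t E"
    and "\<forall>i\<in>{1..t}. \<forall>a. 0 \<le> U i $ a" "\<forall>i\<in>{1..t}. (\<Sum>a\<in>UNIV. U i $ a) = 1"
  shows "seg E U \<subseteq> std_simplex"
proof -
  have "closed_segment (U i) (U j) \<subseteq> std_simplex" if "{i, j} \<in> E" for i j
  proof -
    have "i \<in> {1..t}" "j \<in> {1..t}"
      using that assms(1) by (auto simp: simple_graph_def)
    then have "U i \<in> std_simplex" "U j \<in> std_simplex"
      using assms by (auto simp: std_simplex_def)
    then show ?thesis
      by (simp add: closed_segment_subset convex_std_simplex)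
  qed
  then show ?thesis
    unfolding seg_def by blast
qed

lemma compact_seg:
  assumes "simple_graph t E"
  shows "compact (seg E U)"
proof -
  let ?Q = "{(i, j) \<in> {1..t} \<times> {1..t}. {i, j} \<in> E}"
  have "i \<in> {1..t} \<and> j \<in> {1..t}" if "{i, j} \<in> E" for i j
    using that assms by (auto simp: simple_graph_def)
  then have "seg E U = (\<Union>(i, j)\<in>?Q. closed_segment (U i) (U j))"
    unfolding seg_def by blast
  moreover have "finite ?Q"
    by (rule finite_subset [of _ "{1..t} \<times> {1..t}"]) auto
  ultimately show ?thesis
    by (auto intro: compact_UN)
qed

lemma seg_nonempty:
  assumes "simple_graph t E" "e \<in> E"
  shows "seg E U \<noteq> {}"
proof -
  obtain i j where "{i, j} \<in> E"
    using assms by (metis card_2_iff simple_graph_def)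
  moreover have "U i \<in> closed_segment (U i) (U j)"
    by simp
  ultimately show ?thesis
    unfolding seg_def by blast
qed

text \<open>The boundedness facts \<open>below\<close> and \<open>above\<close> are what makes the infimum and the supremum in the
  reals meaningful; norms on the simplex are at most 1, so distances in it are at most 2.\<close>

lemma std_simplex_subset_closure:
  fixes S :: "nat \<Rightarrow> (real^'n) set"
  assumes S: "\<And>k. S k \<subseteq> std_simplex" "\<And>k. S k \<noteq> {}"
    and lim: "(\<lambda>k. SUP x\<in>std_simplex. INF y\<in>S k. norm (x - y)) \<longlonglongrightarrow> 0"
  shows "std_simplex \<subseteq> closure (\<Union>k. S k)"
proof
  fix x :: "real^'n"
  assume x: "x \<in> std_simplex"
  have below: "bdd_below ((\<lambda>y. norm (z - y)) ` S k)" for z k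
    by (rule bdd_belowI [of _ 0]) auto
  have above: "bdd_above ((\<lambda>z. INF y\<in>S k. norm (z - y)) ` std_simplex)" for k
  proof (rule bdd_aboveI2)
    fix z :: "real^'n"
    assume z: "z \<in> std_simplex"
    obtain y where y: "y \<in> S k"
      using S by blast
    have "(INF y\<in>S k. norm (z - y)) \<le> norm (z - y)"
      by (rule cINF_lower [OF below y])
    also have "\<dots> \<le> norm z + norm y"
      by (rule norm_triangle_ineq4)
    also have "\<dots> \<le> 2"
      using z y S std_simplex_norm_le_1 [of z] std_simplex_norm_le_1 [of y] by force
    finally show "(INF y\<in>S k. norm (z - y)) \<le> 2" .
  qed
  have "\<exists>y\<in>(\<Union>k. S k). dist y x < e" if "e > 0" for e
  proof -
    obtain k where "(SUP x\<in>std_simplex. INF y\<in>S k. norm (x - y)) < e"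
      using order_tendstoD(2) [OF lim \<open>e > 0\<close>] eventually_happens' by force
    then have "(INF y\<in>S k. norm (x - y)) < e"
      using cSUP_upper [OF x above] by (rule le_less_trans [rotated])
    then obtain y where "y \<in> S k" "norm (x - y) < e"
      using cINF_less_iff [OF S(2) below] by blast
    then show ?thesis
      unfolding dist_norm norm_minus_commute [of _ x] by blast
  qed
  then show "x \<in> closure (\<Union>k. S k)"
    by (simp add: closure_approachable)
qed

lemma convex_cone_incseq_Union:
  assumes K: "incseq K" "\<And>k. convex_cone (K k)"
  shows "convex_cone (\<Union>k. K k)"
  unfolding convex_cone_iff
proof (intro conjI ballI allI impI)
  fix x y
  assume "x \<in> (\<Union>k. K k)" "y \<in> (\<Union>k. K k)"
  then obtain i j where "x \<in> K i" "y \<in> K j"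
    by blast
  then have "x \<in> K (max i j)" "y \<in> K (max i j)"
    using incseqD [OF K(1), of i "max i j"] incseqD [OF K(1), of j "max i j"] by auto
  then show "x + y \<in> (\<Union>k. K k)"
    using convex_cone_add [OF K(2)] by blast
qed (use K convex_cone_contains_0 convex_cone_scaleR in blast)+

lemma convex_cone_closure:
  fixes K :: "'a::euclidean_space set"
  assumes "convex_cone K"
  shows "convex_cone (closure K)"
  using assms closure_subset convex_cone_contains_0 [OF assms]
  by (auto simp: convex_cone_def convex_closure conic_closure)

text \<open>The closure of the increasing union is itself a convex cone, and by continuity it contains the
  rank-one matrices of all limits of points of the sets \<open>S k\<close>.\<close>

lemma cp_mats_subset_closure:
  fixes S :: "nat \<Rightarrow> (real^'n) set"
  assumes "incseq S" "std_simplex \<subseteq> closure (\<Union>k. S k)"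
  shows "cp_mats \<subseteq> closure (\<Union>k. convex_cone hull (rank_one ` S k))"
  unfolding cp_mats_eq_hull
proof (rule hull_minimal)
  let ?K = "\<Union>k. convex_cone hull (rank_one ` S k)"
  have "incseq (\<lambda>k. convex_cone hull (rank_one ` S k))"
    using assms(1) by (auto simp: incseq_def intro!: hull_mono image_mono)
  then show "convex_cone (closure ?K)"
    by (intro convex_cone_closure convex_cone_incseq_Union convex_cone_convex_cone_hull)
  have "rank_one ` (\<Union>k. S k) \<subseteq> ?K"
    unfolding image_UN by (intro UN_mono hull_subset order_refl)
  then have "rank_one ` closure (\<Union>k. S k) \<subseteq> closure ?K"
    using closure_subset by (intro image_closure_subset continuous_rank_one closed_closure) (rule order_trans)
  then show "rank_one ` std_simplex \<subseteq> closure ?K"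
    using assms(2) by blast
qed

section \<open>Convergence of the approximations\<close>

text \<open>On the feasible set the traces of the products with \<open>C\<close> and with the dual slack matrix differ by a
  constant, so coercivity of the slack matrix carries over to the objective.\<close>

lemma bounded_feasible_sublevel:
  fixes C :: "real^'n^'n"
  assumes "C - (\<Sum>i=1..m. y i *\<^sub>R A i) \<in> sym_interior cop_mats"
  shows "bounded {X \<in> feasible m A b cp_mats. trace (C ** X) \<le> c}"
proof -
  let ?Z = "C - (\<Sum>i=1..m. y i *\<^sub>R A i)"
  obtain e where e: "e > 0" "\<And>X. X \<in> cp_mats \<Longrightarrow> e * norm X \<le> trace (?Z ** X)"
    using interior_copositive_coercive [OF assms] by blast
  have "norm X \<le> (c - (\<Sum>i=1..m. y i * b i)) / e"
    if X: "X \<in> feasible m A b cp_mats" "trace (C ** X) \<le> c" for X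
  proof -
    have "trace (?Z ** X) = trace (C ** X) - (\<Sum>i=1..m. y i * trace (A i ** X))"
      by (simp add: linear_diff [OF linear_trace_left] linear_sum [OF linear_trace_left]
          linear_cmul [OF linear_trace_left])
    also have "\<dots> = trace (C ** X) - (\<Sum>i=1..m. y i * b i)"
      using X by (simp add: feasible_def)
    finally have "e * norm X \<le> c - (\<Sum>i=1..m. y i * b i)"
      using e(2) [of X] X by (simp add: feasible_def)
    then show ?thesis
      using e(1) by (simp add: field_simps)
  qed
  then show ?thesis
    unfolding bounded_iff by blast
qed

lemma opt_val_eq_solution_value:
  assumes "X \<in> solutions C F"
  shows "opt_val C F = ereal (trace (C ** X))"
  using assms unfolding opt_val_def solutions_def by (intro INF_eqI) auto

theorem theorem5:
  fixes C :: "real^'n^'n"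
    and m :: nat
    and A :: "nat \<Rightarrow> real^'n^'n"
    and b :: "nat \<Rightarrow> real"
    and t :: "nat \<Rightarrow> nat"
    and E :: "nat \<Rightarrow> nat set set"
    and U :: "nat \<Rightarrow> nat \<Rightarrow> real^'n"
  defines "P \<equiv> feasible m A b cp_mats"
    and "Pk \<equiv> \<lambda>k. feasible m A b (sdd_cone (t k) (E k) (U k))"
  assumes C_sym: "C \<in> sym_mats"
    and A_sym: "\<forall>i\<in>{1..m}. A i \<in> sym_mats"
    and A1: "P \<noteq> {}"
    and A2: "(\<lambda>X. \<lambda>i\<in>{1..m}. trace (A i ** X)) ` sym_mats = {1..m} \<rightarrow>\<^sub>E UNIV"
    and A3: "\<exists>y :: nat \<Rightarrow> real. C - (\<Sum>i=1..m. y i *\<^sub>R A i) \<in> sym_interior cop_mats"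
    and strictly_feasible: "\<exists>X \<in> sym_interior cp_mats. \<forall>i\<in>{1..m}. trace (A i ** X) = b i"
    and enlarging: "positively_enlarging t E U"
    and dense: "(\<lambda>k. SUP x\<in>std_simplex. INF y\<in>seg (E k) (U k). norm (x - y)) \<longlonglongrightarrow> 0"
  shows "((\<forall>\<^sub>F k in sequentially. \<bar>opt_val C (Pk k)\<bar> \<noteq> \<infinity>) \<and>
          (\<lambda>k. opt_val C (Pk k)) \<longlonglongrightarrow> opt_val C P) \<and>
         (\<exists>k0. (\<forall>k\<ge>k0. solutions C (Pk k) \<noteq> {}) \<and>
               bounded (\<Union>k\<in>{k0..}. solutions C (Pk k))) \<and>
         (\<forall>X :: nat \<Rightarrow> real^'n^'n.
            (\<forall>k. solutions C (Pk k) \<noteq> {} \<longrightarrow> X k \<in> solutions C (Pk k)) \<longrightarrow>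
            (\<forall>Xbar. (\<exists>r. strict_mono r \<and> (\<forall>j. solutions C (Pk (r j)) \<noteq> {}) \<and>
                         (X \<circ> r) \<longlonglongrightarrow> Xbar)
                    \<longrightarrow> Xbar \<in> solutions C P))"
proof -
  define f where "f X = trace (C ** X)" for X
  define M where "M = {X :: real^'n^'n. \<forall>i\<in>{1..m}. trace (A i ** X) = b i}"
  define S where "S k = seg (E k) (U k)" for k
  define K where "K k = sdd_cone (t k) (E k) (U k)" for k
  let ?L = "cp_mats :: (real^'n^'n) set"

  have cont_trace: "continuous_on UNIV (\<lambda>X. trace (D ** X))" for D :: "real^'n^'n"
    by (intro linear_continuous_on) (simp add: linear_linear linear_trace_right)
  have f: "continuous_on UNIV f"
    unfolding f_def by (rule cont_trace)
  have M: "affine M" "closed M"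
  proof -
    show "affine M"
      unfolding affine_def M_def
      by (auto simp: linear_add [OF linear_trace_right] linear_cmul [OF linear_trace_right]
          simp flip: distrib_right)
    have "M = (\<Inter>i\<in>{1..m}. {X. trace (A i ** X) = b i})"
      by (auto simp: M_def)
    moreover have "closed {X. trace (A i ** X) = b i}" for i
      by (intro closed_Collect_eq cont_trace continuous_intros)
    ultimately show "closed M"
      by auto
  qed
  have P_eq: "P = ?L \<inter> M" and Pk_eq: "Pk k = K k \<inter> M" for k
    by (auto simp: P_def Pk_def feasible_def M_def K_def)
  have sol_eq: "solutions C F = minimizers f F" for F
    by (simp add: solutions_def f_def)

  have G: "simple_graph (t k) (E k)" for k
    using enlarging by (simp add: positively_enlarging_def)
  have S_simplex: "S k \<subseteq> std_simplex" for k
    unfolding S_def using enlarging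
    by (intro seg_subset_std_simplex [OF G]) (simp_all add: positively_enlarging_def)
  have S_nonempty: "S k \<noteq> {}" for k
  proof -
    have "1 \<le> t k"
      using enlarging zero_less_card_finite [where 'a = 'n] unfolding positively_enlarging_def
      by (metis One_nat_def Suc_leI le_trans)
    then have "1 \<in> {1..t k}"
      by simp
    then obtain e where "e \<in> E k"
      using enlarging unfolding positively_enlarging_def by blast
    then show ?thesis
      unfolding S_def by (rule seg_nonempty [OF G])
  qed
  have "incseq S"
    using enlarging by (intro incseq_SucI) (simp add: positively_enlarging_def S_def)
  have K_eq: "K k = convex_cone hull (rank_one ` S k)" for k
    unfolding K_def S_def by (rule sdd_cone_eq_hull [OF G])
  have K: "incseq K"
    unfolding K_eq [abs_def] using \<open>incseq S\<close> by (auto simp: incseq_def intro!: hull_mono image_mono)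
  have K_closed: "closed (K k)" for k
    unfolding K_eq using S_simplex by (intro closed_hull_rank_one) (simp_all add: S_def compact_seg [OF G])
  have K_le: "K k \<subseteq> ?L" for k
    unfolding K_eq cp_mats_eq_hull by (intro hull_mono image_mono S_simplex)
  have L_convex: "convex ?L"
    unfolding cp_mats_eq_hull by (rule convex_convex_cone_hull)
  have "std_simplex \<subseteq> closure (\<Union>k. S k)"
    using std_simplex_subset_closure [OF S_simplex S_nonempty] dense by (simp add: S_def)
  then have "?L \<subseteq> closure (\<Union>k. K k)"
    unfolding K_eq by (rule cp_mats_subset_closure [OF \<open>incseq S\<close>])
  moreover have "convex (\<Union>k. K k)"
  proof -
    have "convex_cone (\<Union>k. K k)"
      by (rule convex_cone_incseq_Union [OF K]) (simp add: K_eq convex_cone_convex_cone_hull)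
    then show ?thesis
      by (simp add: convex_cone_def)
  qed
  ultimately have inner: "rel_interior ?L \<subseteq> (\<Union>k. K k)"
    using L_convex K_le by (intro rel_interior_subset_dense_convex_subset) auto

  obtain X0 where X0: "X0 \<in> rel_interior ?L \<inter> M"
  proof -
    obtain X0 where "X0 \<in> sym_interior ?L" "X0 \<in> M"
      using strictly_feasible by (auto simp: M_def)
    moreover have "?L \<subseteq> sym_mats"
      by (auto simp: cp_mats_def)
    ultimately show thesis
      using that sym_interior_subset_rel_interior by blast
  qed
  then obtain k0 where k0: "X0 \<in> K k0"
    using inner by blast

  have bounded: "bounded {X \<in> ?L \<inter> M. f X \<le> c}" for c
  proof -
    obtain y where "C - (\<Sum>i=1..m. y i *\<^sub>R A i) \<in> sym_interior cop_mats"
      using A3 by blast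
    then show ?thesis
      unfolding P_eq [symmetric] P_def f_def by (rule bounded_feasible_sublevel)
  qed
  have sol_P: "solutions C P \<noteq> {}"
    unfolding sol_eq
    by (rule minimizers_nonempty_coercive)
      (use A1 f M bounded closed_cp_mats in \<open>auto simp: P_eq intro: closed_Int\<close>)
  then obtain Xs where Xs: "Xs \<in> solutions C P"
    by blast
  have feas_k: "X0 \<in> Pk k" if "k \<ge> k0" for k
    using k0 X0 incseqD [OF K that] by (auto simp: Pk_eq)
  have sol_k: "solutions C (Pk k) \<noteq> {}" if "k \<ge> k0" for k
    unfolding sol_eq
  proof (rule minimizers_nonempty_coercive)
    show "closed (Pk k)"
      by (simp add: Pk_eq K_closed M closed_Int)
    show "Pk k \<noteq> {}"
      using feas_k [OF that] by blast
    show "bounded {X \<in> Pk k. f X \<le> c}" for c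
      by (rule bounded_subset [OF bounded [of c]]) (use K_le in \<open>auto simp: Pk_eq\<close>)
  qed (rule f)

  have values_converge: "(\<lambda>k. f (X k)) \<longlonglongrightarrow> f Xs"
    if "\<And>k. k \<ge> k0 \<Longrightarrow> X k \<in> solutions C (Pk k)" for X
  proof (rule minimal_values_converge [OF K _ L_convex M(1) f inner X0])
    show "(\<Union>k. K k) \<subseteq> ?L"
      using K_le by blast
    show "Xs \<in> minimizers f (?L \<inter> M)"
      using Xs by (simp add: sol_eq P_eq)
    show "X k \<in> minimizers f (K k \<inter> M)" if "k \<ge> k0" for k
      using \<open>\<And>k. k \<ge> k0 \<Longrightarrow> X k \<in> solutions C (Pk k)\<close> [OF that] by (simp add: sol_eq Pk_eq)
  qed

  define Y where "Y k = (SOME X. X \<in> solutions C (Pk k))" for k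
  have Y: "Y k \<in> solutions C (Pk k)" if "k \<ge> k0" for k
    using sol_k [OF that] unfolding Y_def by (simp add: some_in_eq)
  have opt_k: "opt_val C (Pk k) = ereal (f (Y k))" if "k \<ge> k0" for k
    unfolding f_def by (rule opt_val_eq_solution_value [OF Y [OF that]])
  have opt_P: "opt_val C P = ereal (f Xs)"
    unfolding f_def by (rule opt_val_eq_solution_value [OF Xs])

  have finite_vals: "\<forall>\<^sub>F k in sequentially. \<bar>opt_val C (Pk k)\<bar> \<noteq> \<infinity>"
    unfolding eventually_sequentially by (intro exI [of _ k0]) (simp add: opt_k)
  have "(\<lambda>k. ereal (f (Y k))) \<longlonglongrightarrow> ereal (f Xs)"
    using values_converge [OF Y] by simp
  moreover have "\<forall>\<^sub>F k in sequentially. ereal (f (Y k)) = opt_val C (Pk k)"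
    using opt_k unfolding eventually_sequentially by metis
  ultimately have lim_vals: "(\<lambda>k. opt_val C (Pk k)) \<longlonglongrightarrow> opt_val C P"
    unfolding opt_P by (rule Lim_transform_eventually)

  \<comment> \<open>The point \<open>X0\<close> competes in all these problems, so its value bounds all solution values.\<close>
  have "(\<Union>k\<in>{k0..}. solutions C (Pk k)) \<subseteq> {X \<in> ?L \<inter> M. f X \<le> f X0}"
    using feas_k K_le by (fastforce simp: sol_eq Pk_eq)
  then have bounded_sols: "bounded (\<Union>k\<in>{k0..}. solutions C (Pk k))"
    using bounded bounded_subset by blast

  have accumulation: "Xbar \<in> solutions C P"
    if X: "\<forall>k. solutions C (Pk k) \<noteq> {} \<longrightarrow> X k \<in> solutions C (Pk k)"
      and r: "strict_mono r" "\<forall>j. solutions C (Pk (r j)) \<noteq> {}" "(X \<circ> r) \<longlonglongrightarrow> Xbar" for X Xbar r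
  proof -
    have "closed (?L \<inter> M)"
      by (simp add: closed_cp_mats M closed_Int)
    moreover have "(X \<circ> r) j \<in> ?L \<inter> M" for j
      using X r(2) K_le by (fastforce simp: sol_eq Pk_eq)
    ultimately have "Xbar \<in> P"
      unfolding P_eq using r(3) closed_sequentially by blast
    have "(\<lambda>k. f (X k)) \<longlonglongrightarrow> f Xs"
      using X sol_k by (intro values_converge) blast
    then have "(\<lambda>j. f (X (r j))) \<longlonglongrightarrow> f Xs"
      using LIMSEQ_subseq_LIMSEQ [OF _ r(1)] by (fastforce simp: o_def)
    moreover have "(\<lambda>j. f (X (r j))) \<longlonglongrightarrow> f Xbar"
      using continuous_on_tendsto_compose [OF f r(3)] by (simp add: o_def)
    ultimately have "f Xbar = f Xs"
      using LIMSEQ_unique by blast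
    with \<open>Xbar \<in> P\<close> Xs show ?thesis
      by (simp add: sol_eq)
  qed

  show ?thesis
    using finite_vals lim_vals sol_k bounded_sols accumulation by blast
qed

end
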